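(* Let $n$ be a positive integer and let $f:\mathbb E\to\mathbb R\cup\{+\infty\}$ be a proper extended real function which is lower semicontinuous at the point $x\in\mathrm{dom}\,f$. Suppose that for every direction $u\in\mathbb E$, $u\neq0$, at least one of the following conditions $(G_k)$, $k=0,1,\dots,n$, is satisfied (the Ginchev derivatives occurring in it existing): $(G_0)$: $f^{[0]}_-(x;u)>f(x)$; $(G_k)$, $1\le k\le n$: $f^{[0]}_-(x;u)=f(x)$, $f^{[i]}_-(x;u)=0$ for all integers $i$ with $1\le i<k$, and $f^{[k]}_-(x;u)>0$. Suppose additionally that $f^{[i]}_-(x;0)=0$ for all $i=1,2,\dots,n$. Then all the lower Hadamard derivatives required in the following conditions exist, and the following conditions are all satisfied: \[ 0\in\partial^{(1)}_-f(x);\qquad 0\in\partial^{(k)}_-f(x;\underbrace{0,0,\dots,0}_{(k-1)\text{ times}})\ \text{ for all } k=2,3,\dots,n-1; \] \[ f^{(n)}_-(x;\underbrace{0,0,\dots,0}_{(n-1)\text{ times}};u)>0\ \text{ for every } u\in\mathbb E,\ u\ne0. \]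
   Context: $\mathbb E$ is a real finite-dimensional Euclidean space. $L^1(\mathbb E)=L(\mathbb E,\mathbb R)$ is the space of continuous linear functionals on $\mathbb E$ and, for $n>1$, $L^n(\mathbb E)=L(\mathbb E,L^{n-1}(\mathbb E))$. A proper extended real function is $f:\mathbb E\to\mathbb R\cup\{+\infty\}$ having at least one finite value; $\mathrm{dom}\,f=\{x\mid f(x)<+\infty\}$. For $x\in\mathrm{dom}\,f$ and $u\in\mathbb E$, \[ f^{(1)}_-(x;u)=\liminf_{t\downarrow 0,\,u'\to u}t^{-1}[f(x+tu')-f(x)],\qquad \partial^{(1)}_-f(x)=\{x^*\in L^1(\mathbb E)\mid x^*(u)\le f^{(1)}_-(x;u)\ \forall u\in\mathbb E\}. \] Recursively, for $n>1$: given $x^*_i\in\partial^{(i)}_-f(x;x_1^*,\dots,x_{i-1}^* )$ for $i=1,\dots,n-1$ (for $i=1$ this means $x_1^*\in\partial^{(1)}_-f(x)$), the lower Hadamard derivative of order $n$ is \[ f^{(n)}_-(x;x_1^*,\dots,x_{n-1}^*;u)=\liminf_{t\downarrow0,\,u'\to u} n!\,t^{-n}\Big[f(x+tu')-f(x)-\sum_{i=1}^{n-1}\frac{t^i}{i!}\,x_i^*\underbrace{(u')\cdots(u')}_{i\text{ times}}\Big]\in[-\infty,+\infty], \] and it is defined (exists) only for such $x_i^*$. The lower Hadamard subdifferential of order $n$ is \[ \partial^{(n)}_-f(x;x_1^*,\dots,x_{n-1}^* )=\{x^*\in L^n(\mathbb E)\mid x^*\underbrace{(u)\cdots(u)}_{n\text{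 times}}\le f^{(n)}_-(x;x_1^*,\dots,x_{n-1}^*;u)\ \forall u\in\mathbb E\}. \] For order $1$ with no zeros, $f^{(1)}_-(x;0,\dots,0;u)$ means $f^{(1)}_-(x;u)$. Ginchev's derivatives at $x\in\mathrm{dom}\,f$ in direction $u\in\mathbb E$ are \[ f^{[0]}_-(x;u)=\liminf_{t\downarrow0,\,u'\to u}f(x+tu'),\qquad f^{[k]}_-(x;u)=\liminf_{t\downarrow0,\,u'\to u}\frac{k!}{t^k}\Big[f(x+tu')-\sum_{i=0}^{k-1}\frac{t^i}{i!}f^{[i]}_-(x;u)\Big],\quad k\ge1, \] where $f^{[k]}_-(x;u)$ exists when $f^{[i]}_-(x;u)$, $i=0,\dots,k-1$, are all finite. *)

theory Defs
  imports "HOL-Analysis.Analysis"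
begin

definition proper_fun :: "('a \<Rightarrow> ereal) \<Rightarrow> bool" where
  "proper_fun f \<longleftrightarrow> (\<forall>y. f y \<noteq> -\<infinity>) \<and> (\<exists>y. f y < \<infinity>)"

definition edom :: "('a \<Rightarrow> ereal) \<Rightarrow> 'a set" where
  "edom f = {y. f y < \<infinity>}"

definition lsc_at :: "('a::topological_space \<Rightarrow> ereal) \<Rightarrow> 'a \<Rightarrow> bool" where
  "lsc_at f x \<longleftrightarrow> (\<forall>c. c < f x \<longrightarrow> (\<forall>\<^sub>F y in nhds x. c < f y))"

(* The filter for the joint limit t \<down> 0, u' \<rightarrow> u.  The value u' = u is allowed. *)
definition dir_filter :: "'a::topological_space \<Rightarrow> (real \<times> 'a) filter" where
  "dir_filter u = at_right 0 \<times>\<^sub>F nhds u"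

text \<open>
  The iterated spaces $L^n(E) = L(E, L^{n-1}(E))$, with $L^0(E) = R$.  Since the type of an
  iterated functional would depend on $n$, an element $T$ of $L^n(E)$ is encoded by the function
  sending a list $[u_1, \dots, u_n]$ to $T(u_1)\cdots(u_n)$, and sending all lists of another length
  to 0.  Partial application $T(u)$ is then \<open>\<lambda>us. T (u # us)\<close>.  As $E$ is finite-dimensional, the norm
  topology of $L^{n-1}(E)$ is that of pointwise convergence, so that $u \mapsto T(u)$ is
  linear and continuous iff it is so after evaluation at every list.
\<close>

fun Lspace :: "nat \<Rightarrow> ('a::euclidean_space list \<Rightarrow> real) set" where
  "Lspace 0 = {T. \<forall>us. us \<noteq> [] \<longrightarrow> T us = 0}"
| "Lspace (Suc n) = {T. T [] = 0 \<and> (\<forall>u. (\<lambda>us. T (u # us)) \<in> Lspace n)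
      \<and> (\<forall>us. bounded_linear (\<lambda>u. T (u # us)))}"

definition zero_form :: "'a list \<Rightarrow> real" where
  "zero_form = (\<lambda>us. 0)"

definition diag_apply :: "('a list \<Rightarrow> real) \<Rightarrow> nat \<Rightarrow> 'a \<Rightarrow> real" where
  "diag_apply T n u = T (replicate n u)"

(* Lower Hadamard derivative of order n = length Ts + 1 for the list Ts = [x_1*, ..., x_(n-1)*].
   This is only its value; it is said to exist when hadamard_exists f x Ts holds. *)
definition lower_hadamard ::
  "('a::euclidean_space \<Rightarrow> ereal) \<Rightarrow> 'a \<Rightarrow> ('a list \<Rightarrow> real) list \<Rightarrow> 'a \<Rightarrow> ereal" where
  "lower_hadamard f x Ts u =
     (let n = length Ts + 1 in
      Liminf (dir_filter u) (\<lambda>(t, u'). ereal (fact n / t ^ n) *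
        (f (x + t *\<^sub>R u') - f x
          - ereal (\<Sum>i = 1..n - 1. t ^ i / fact i * diag_apply (Ts ! (i - 1)) i u'))))"

definition hadamard_subdiff ::
  "('a::euclidean_space \<Rightarrow> ereal) \<Rightarrow> 'a \<Rightarrow> ('a list \<Rightarrow> real) list \<Rightarrow> ('a list \<Rightarrow> real) set" where
  "hadamard_subdiff f x Ts =
     (let n = length Ts + 1 in
      {T \<in> Lspace n. \<forall>u. ereal (diag_apply T n u) \<le> lower_hadamard f x Ts u})"

definition hadamard_exists ::
  "('a::euclidean_space \<Rightarrow> ereal) \<Rightarrow> 'a \<Rightarrow> ('a list \<Rightarrow> real) list \<Rightarrow> bool" where
  "hadamard_exists f x Ts \<longleftrightarrow>
     x \<in> edom f \<and> (\<forall>i < length Ts. Ts ! i \<in> hadamard_subdiff f x (take i Ts))"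

(* The value of Ginchev's derivative is meaningful only under ginchev_exists f x u k. *)
fun ginchev :: "('a::euclidean_space \<Rightarrow> ereal) \<Rightarrow> 'a \<Rightarrow> 'a \<Rightarrow> nat \<Rightarrow> ereal" where
  "ginchev f x u 0 = Liminf (dir_filter u) (\<lambda>(t, u'). f (x + t *\<^sub>R u'))"
| "ginchev f x u (Suc k) =
     Liminf (dir_filter u) (\<lambda>(t, u'). ereal (fact (Suc k) / t ^ Suc k) *
       (f (x + t *\<^sub>R u') - (\<Sum>i < Suc k. ereal (t ^ i / fact i) * ginchev f x u i)))"

definition ginchev_exists ::
  "('a::euclidean_space \<Rightarrow> ereal) \<Rightarrow> 'a \<Rightarrow> 'a \<Rightarrow> nat \<Rightarrow> bool" where
  "ginchev_exists f x u k \<longleftrightarrow> x \<in> edom f \<and> (\<forall>i < k. \<bar>ginchev f x u i\<bar> \<noteq> \<infinity>)"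

definition condG :: "('a::euclidean_space \<Rightarrow> ereal) \<Rightarrow> 'a \<Rightarrow> 'a \<Rightarrow> nat \<Rightarrow> bool" where
  "condG f x u k \<longleftrightarrow> ginchev_exists f x u k \<and>
     (if k = 0 then ginchev f x u 0 > f x
      else ginchev f x u 0 = f x \<and> (\<forall>i. 1 \<le> i \<and> i < k \<longrightarrow> ginchev f x u i = 0)
           \<and> ginchev f x u k > 0)"

end

theory Submission
  imports Defs
begin

text \<open>
  When all the functionals fed into the lower Hadamard derivatives vanish, the derivative of
  order \<open>m\<close> is the lower limit \<open>zero_hadamard f x m u\<close> of the quotients
  \<open>m! (f (x + t u') - f x) / t^m\<close>.  Ginchev's derivative of order \<open>m\<close> is this same lower limit as
  soon as the Ginchev derivatives of smaller order are \<open>f x, 0, \<dots>, 0\<close>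
  (\<open>ginchev_eq_zero_hadamard\<close>).  Hence \<open>(G\<^sub>k)\<close> says that \<open>zero_hadamard f x m u\<close> vanishes for
  \<open>m < k\<close> and is positive for \<open>m = k\<close>.  It remains positive for \<open>m > k\<close>, because a
  larger power of a small \<open>t\<close> in the denominator only enlarges a positive quotient
  (\<open>zero_hadamard_pos_mono\<close>).  So in every direction \<open>u \<noteq> 0\<close> the derivatives of orders
  \<open>1, \<dots>, n\<close> are nonnegative and the last one is positive.

  The direction \<open>u = 0\<close> has to be treated apart.  There, lower semicontinuity gives
  \<open>f x\<close> for the Ginchev derivative of order 0 (\<open>ginchev_0_direction_0\<close>), and the assumption on
  the higher ones makes all the Hadamard derivatives vanish.  Nonnegativity in all directions says
  that the zero functional lies in each of the subdifferentials, and this is also what the existence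
  of the derivatives of higher order requires.
\<close>

text \<open>The order \<open>m = 0\<close> is included so that \<open>(G\<^sub>0)\<close> can be handled together with the other
  conditions.\<close>

definition zero_hadamard :: "('a::euclidean_space \<Rightarrow> ereal) \<Rightarrow> 'a \<Rightarrow> nat \<Rightarrow> 'a \<Rightarrow> ereal" where
  "zero_hadamard f x m u =
     Liminf (dir_filter u) (\<lambda>(t, u'). ereal (fact m / t ^ m) * (f (x + t *\<^sub>R u') - f x))"

lemma lower_hadamard_zero_forms:
  "lower_hadamard f x (replicate k zero_form) u = zero_hadamard f x (Suc k) u"
proof -
  have "(\<Sum>i = 1..k. t ^ i / fact i * diag_apply (replicate k zero_form ! (i - 1)) i v) = 0"
    for t :: real and v :: 'a
    by (intro sum.neutral) (auto simp: diag_apply_def zero_form_def)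
  then show ?thesis
    by (simp add: lower_hadamard_def zero_hadamard_def Let_def flip: zero_ereal_def)
qed

lemma zero_form_in_Lspace: "zero_form \<in> Lspace n"
proof (induction n)
  case (Suc n)
  then show ?case by (simp add: zero_form_def)
qed (simp add: zero_form_def)

lemma zero_form_in_hadamard_subdiff_iff:
  "zero_form \<in> hadamard_subdiff f x (replicate k zero_form) \<longleftrightarrow>
     (\<forall>u. 0 \<le> zero_hadamard f x (Suc k) u)"
proof -
  have "diag_apply zero_form (Suc k) u = 0" for u :: 'a
    by (simp add: diag_apply_def zero_form_def)
  then show ?thesis
    by (simp add: hadamard_subdiff_def Let_def lower_hadamard_zero_forms zero_form_in_Lspace
        flip: zero_ereal_def del: Lspace.simps)
qed

lemma hadamard_exists_zero_forms:
  assumes "x \<in> edom f" and "\<And>i u. i < k \<Longrightarrow> 0 \<le> zero_hadamard f x (Suc i) u"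
  shows "hadamard_exists f x (replicate k zero_form)"
  using assms by (simp add: hadamard_exists_def min_def zero_form_in_hadamard_subdiff_iff)

lemma eventually_dir_filter_small:
  "\<forall>\<^sub>F (t, u') in dir_filter u. 0 < t \<and> t < 1"
proof -
  have "\<forall>\<^sub>F t in at_right (0::real). 0 < t \<and> t < 1"
    using eventually_at_right_real[of 0 1] by simp
  then show ?thesis
    unfolding dir_filter_def case_prod_unfold
    by (rule eventually_compose_filterlim[OF _ filterlim_fst])
qed

lemma dir_filter_nonbot: "dir_filter u \<noteq> bot"
  by (simp add: dir_filter_def prod_filter_eq_bot)

text \<open>The Taylor sum subtracted in Ginchev's quotient reduces to its constant term \<open>f x\<close>.\<close>

lemma ginchev_eq_zero_hadamard:
  assumes "1 \<le> k" and "ginchev f x u 0 = f x"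
    and "\<And>i. 1 \<le> i \<Longrightarrow> i < k \<Longrightarrow> ginchev f x u i = 0"
  shows "ginchev f x u k = zero_hadamard f x k u"
proof -
  obtain j where k: "k = Suc j" using assms(1) by (cases k) auto
  have "(\<Sum>i<Suc j. ereal (t ^ i / fact i) * ginchev f x u i) = f x" for t :: real
  proof -
    have "(\<Sum>i<j. ereal (t ^ Suc i / fact (Suc i)) * ginchev f x u (Suc i)) = 0"
      by (intro sum.neutral ballI) (simp add: assms(3) k del: ginchev.simps)
    then show ?thesis
      by (simp add: sum.lessThan_Suc_shift assms(2) del: ginchev.simps sum.lessThan_Suc
          flip: one_ereal_def)
  qed
  then show ?thesis
    by (simp only: k ginchev.simps(2) zero_hadamard_def)
qed

lemma zero_hadamard_0:
  assumes "\<bar>f x\<bar> \<noteq> \<infinity>"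
  shows "zero_hadamard f x 0 u = ginchev f x u 0 - f x"
proof -
  obtain r where r: "f x = ereal r" using assms by auto
  have "zero_hadamard f x 0 u
      = Liminf (dir_filter u) (\<lambda>p. (case p of (t, u') \<Rightarrow> f (x + t *\<^sub>R u')) + ereal (- r))"
    by (simp add: zero_hadamard_def r case_prod_unfold minus_ereal_def flip: one_ereal_def)
  also have "\<dots> = ginchev f x u 0 - f x"
    by (subst Liminf_add_ereal_right) (simp_all add: dir_filter_nonbot r minus_ereal_def)
  finally show ?thesis .
qed

text \<open>A positive lower limit keeps the quotient of order \<open>k\<close> above some \<open>c > 0\<close>; for
  \<open>t < 1\<close> the factor \<open>m! / t^m\<close> is at least \<open>k! / t^k\<close>, so the quotient of order
  \<open>m\<close> stays above the same \<open>c\<close>.\<close>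

lemma zero_hadamard_pos_mono:
  assumes "0 < zero_hadamard f x k u" and "k \<le> m"
  shows "0 < zero_hadamard f x m u"
proof -
  obtain c where c: "0 < c" "c < zero_hadamard f x k u"
    using assms(1) dense by blast
  have "\<forall>\<^sub>F p in dir_filter u. c <
      (case p of (t, u') \<Rightarrow> ereal (fact k / t ^ k) * (f (x + t *\<^sub>R u') - f x))"
    using c(2) unfolding zero_hadamard_def by (rule less_LiminfD)
  with eventually_dir_filter_small[of u]
  have "\<forall>\<^sub>F p in dir_filter u. c \<le>
      (case p of (t, u') \<Rightarrow> ereal (fact m / t ^ m) * (f (x + t *\<^sub>R u') - f x))"
  proof eventually_elim
    case (elim p)
    obtain t u' where p: "p = (t, u')" by (cases p)
    define d where "d = f (x + t *\<^sub>R u') - f x"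
    have t: "0 < t" "t < 1" and q: "c < ereal (fact k / t ^ k) * d"
      using elim by (auto simp: p d_def)
    have "0 < ereal (fact k / t ^ k) * d"
      using c(1) q by (rule less_trans)
    then have d: "0 \<le> d"
      using t by (auto simp: ereal_zero_less_0_iff divide_less_0_iff)
    have "t ^ m \<le> t ^ k"
      using t assms(2) by (intro power_decreasing) auto
    then have "fact k / t ^ k \<le> fact m / t ^ m"
      using t assms(2) by (intro frac_le fact_mono) auto
    then have "ereal (fact k / t ^ k) * d \<le> ereal (fact m / t ^ m) * d"
      using d by (intro ereal_mult_right_mono) auto
    with q show ?case by (simp add: p d_def)
  qed
  then have "c \<le> zero_hadamard f x m u"
    unfolding zero_hadamard_def by (rule Liminf_bounded)
  with c(1) show ?thesis by (rule less_le_trans)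
qed

lemma condG_imp_zero_hadamard:
  assumes "condG f x u k" and "\<bar>f x\<bar> \<noteq> \<infinity>" and "1 \<le> m"
  shows "0 \<le> zero_hadamard f x m u" and "k \<le> m \<Longrightarrow> 0 < zero_hadamard f x m u"
proof -
  have "0 < zero_hadamard f x k u"
  proof (cases "k = 0")
    case True
    then have "f x < ginchev f x u 0"
      using assms(1) by (simp add: condG_def del: ginchev.simps)
    then show ?thesis
      using assms(2) True by (auto simp: zero_hadamard_0 ereal_less_minus_iff simp del: ginchev.simps)
  next
    case False
    then show ?thesis
      using assms(1) ginchev_eq_zero_hadamard[of k f x u]
      by (simp add: condG_def del: ginchev.simps)
  qed
  then show pos: "0 < zero_hadamard f x m u" if "k \<le> m"
    using that by (rule zero_hadamard_pos_mono)
  show "0 \<le> zero_hadamard f x m u"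
  proof (cases "k \<le> m")
    case False
    then have "zero_hadamard f x m u = 0"
      using assms(1,3) ginchev_eq_zero_hadamard[of m f x u]
      by (simp add: condG_def del: ginchev.simps)
    then show ?thesis by simp
  qed (use pos in auto)
qed

text \<open>Lower semicontinuity gives \<open>\<ge>\<close>.  For \<open>\<le>\<close>, the joint limit admits \<open>u' = 0\<close>, where the
  function takes the value \<open>f x\<close> for every \<open>t\<close>.\<close>

lemma ginchev_0_direction_0:
  assumes "lsc_at f x"
  shows "ginchev f x 0 0 = f x"
proof (rule antisym)
  show "ginchev f x 0 0 \<le> f x"
  proof (rule ccontr)
    assume "\<not> ginchev f x 0 0 \<le> f x"
    then have "\<forall>\<^sub>F p in dir_filter (0::'a). f x < (case p of (t, u') \<Rightarrow> f (x + t *\<^sub>R u'))"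
      by (intro less_LiminfD) simp
    then obtain P Q where "\<forall>\<^sub>F t in at_right (0::real). P t" "\<forall>\<^sub>F v in nhds (0::'a). Q v"
      and PQ: "\<And>t v. P t \<Longrightarrow> Q v \<Longrightarrow> f x < f (x + t *\<^sub>R v)"
      unfolding dir_filter_def eventually_prod_filter by auto
    then obtain t where "P t" and "Q 0"
      using eventually_happens[of P "at_right 0"] eventually_nhds_x_imp_x[of Q 0] by auto
    then have "f x < f (x + t *\<^sub>R 0)" by (rule PQ)
    then show False by simp
  qed
next
  have lim: "((\<lambda>p. x + fst p *\<^sub>R snd p) \<longlongrightarrow> x) (dir_filter 0)"
  proof -
    have "(fst \<longlongrightarrow> 0) (dir_filter (0::'a))"
      unfolding dir_filter_def
      by (rule filterlim_mono[OF filterlim_fst _ order_refl]) (simp add: at_within_def)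
    moreover have "(snd \<longlongrightarrow> 0) (dir_filter (0::'a))"
      unfolding dir_filter_def by (rule filterlim_snd)
    ultimately have "((\<lambda>p. x + fst p *\<^sub>R snd p) \<longlongrightarrow> x + 0 *\<^sub>R 0) (dir_filter 0)"
      by (intro tendsto_intros)
    then show ?thesis by simp
  qed
  have "\<forall>\<^sub>F p in dir_filter 0. c < f (x + fst p *\<^sub>R snd p)" if "c < f x" for c
  proof -
    have "\<forall>\<^sub>F y in nhds x. c < f y"
      using assms that by (simp add: lsc_at_def)
    then show ?thesis using lim by (rule eventually_compose_filterlim)
  qed
  then show "f x \<le> ginchev f x 0 0"
    unfolding ginchev.simps(1) le_Liminf_iff case_prod_unfold by blast
qed

theorem proposition6p5:
  fixes f :: "'a::euclidean_space \<Rightarrow> ereal" and x :: 'a and n :: nat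
  assumes "n \<ge> 1"
    and "proper_fun f"
    and "x \<in> edom f"
    and "lsc_at f x"
    and "\<And>u. u \<noteq> 0 \<Longrightarrow> \<exists>k\<le>n. condG f x u k"
    and "\<And>i. 1 \<le> i \<Longrightarrow> i \<le> n \<Longrightarrow> ginchev_exists f x 0 i \<and> ginchev f x 0 i = 0"
  shows "(\<forall>k\<in>{1..n}. hadamard_exists f x (replicate (k - 1) zero_form))
    \<and> zero_form \<in> hadamard_subdiff f x []
    \<and> (\<forall>k\<in>{2..n - 1}. zero_form \<in> hadamard_subdiff f x (replicate (k - 1) zero_form))
    \<and> (\<forall>u. u \<noteq> 0 \<longrightarrow> lower_hadamard f x (replicate (n - 1) zero_form) u > 0)"
proof -
  have fin: "\<bar>f x\<bar> \<noteq> \<infinity>"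
    using assms(2,3) by (auto simp: proper_fun_def edom_def)
  have nonneg: "0 \<le> zero_hadamard f x m u" if m: "1 \<le> m" "m \<le> n" for m u
  proof (cases "u = 0")
    case True
    have "ginchev f x 0 m = zero_hadamard f x m 0"
      using m assms(6) by (intro ginchev_eq_zero_hadamard ginchev_0_direction_0 assms(4)) auto
    then show ?thesis
      using True assms(6)[OF m] by simp
  next
    case False
    then obtain k where "condG f x u k" using assms(5)[of u] by auto
    then show ?thesis using fin m(1) by (rule condG_imp_zero_hadamard(1))
  qed
  have subdiff: "zero_form \<in> hadamard_subdiff f x (replicate (k - 1) zero_form)"
    if "1 \<le> k" "k \<le> n" for k
    using nonneg that by (simp add: zero_form_in_hadamard_subdiff_iff)
  have "hadamard_exists f x (replicate (k - 1) zero_form)" if "k \<in> {1..n}" for k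
    using that by (intro hadamard_exists_zero_forms assms(3) nonneg) auto
  moreover have "lower_hadamard f x (replicate (n - 1) zero_form) u > 0" if "u \<noteq> 0" for u
  proof -
    obtain k where "k \<le> n" "condG f x u k" using assms(5)[of u] \<open>u \<noteq> 0\<close> by auto
    then show ?thesis
      using condG_imp_zero_hadamard(2)[of f x u k n] fin assms(1)
      by (simp add: lower_hadamard_zero_forms)
  qed
  ultimately show ?thesis
    using subdiff[of 1] subdiff assms(1) by auto
qed

end
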